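(* Let $m \neq \pm 1$ be a square-free rational integer, let $f(x) = x^{12} - m \in \mathbb{Z}[x]$, let $\alpha$ be a complex root of $f(x)$, and let $K = \mathbb{Q}(\alpha)$ with ring of integers $\mathbb{Z}_K$. If $m \equiv 2$ or $3 \pmod 4$ and $m \not\equiv \pm 1 \pmod 9$, then $\mathbb{Z}_K = \mathbb{Z}[\alpha]$.
   Context: The polynomial $x^{12}-m$ is irreducible over $\mathbb{Q}$ for such $m$, so $K$ is a number field of degree $12$. *)

theory Defs
  imports
    "HOL-Algebra.Algebraic_Closure_Type"
    "HOL-Algebra.Generated_Fields"
    "HOL-Computational_Algebra.Squarefree"
    "HOL-Number_Theory.Cong"
    Complex_Main
begin

text \<open>
  The HOL-Algebra record \<open>ring_of_type_algebra :: complex ring\<close> is the field of complex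
  numbers. A subfield generated by \<open>{a}\<close> contains \<open>1\<close>, hence \<open>\<rat>\<close>, so it is
  \<open>\<rat>(a)\<close>; likewise the subring generated by \<open>{a}\<close> is \<open>\<int>[a]\<close>
  (lemma \<open>int_adjoin_altdef\<close>).
\<close>

definition rat_adjoin :: "complex \<Rightarrow> complex set" where
  "rat_adjoin a = generate_field ring_of_type_algebra {a}"

definition int_adjoin :: "complex \<Rightarrow> complex set" where
  "int_adjoin a = generate_ring ring_of_type_algebra {a}"

definition ring_of_integers :: "complex set \<Rightarrow> complex set" where
  "ring_of_integers K = {x \<in> K. algebraic_int x}"

lemma ring_of_type_algebra_simps [simp]:
  "carrier (ring_of_type_algebra :: complex ring) = UNIV"
  "\<zero>\<^bsub>ring_of_type_algebra\<^esub> = (0 :: complex)"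
  "\<one>\<^bsub>ring_of_type_algebra\<^esub> = (1 :: complex)"
  "x \<oplus>\<^bsub>ring_of_type_algebra\<^esub> y = (x + y :: complex)"
  "x \<otimes>\<^bsub>ring_of_type_algebra\<^esub> y = (x * y :: complex)"
  by (simp_all add: ring_of_type_algebra_def)

lemma ring_of_type_algebra_uminus [simp]:
  "\<ominus>\<^bsub>ring_of_type_algebra\<^esub> x = (- x :: complex)"
proof -
  interpret field "ring_of_type_algebra :: complex ring"
    by (rule field_from_type_algebra)
  show ?thesis
    by (rule minus_equality) auto
qed

lemma ring_of_type_algebra_inverse [simp]:
  assumes "x \<noteq> 0"
  shows "inv\<^bsub>ring_of_type_algebra\<^esub> x = inverse (x :: complex)"
proof -
  interpret field "ring_of_type_algebra :: complex ring"
    by (rule field_from_type_algebra)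
  show ?thesis
    by (rule comm_inv_char) (use assms in auto)
qed

lemma int_adjoin_altdef:
  "int_adjoin a = range (\<lambda>p :: int poly. poly (map_poly of_int p) a)" (is "_ = ?R")
proof (intro equalityI subsetI)
  have hom:
    "map_poly of_int (- p) = - (map_poly of_int p :: complex poly)"
    "map_poly of_int (p + q) = map_poly of_int p + (map_poly of_int q :: complex poly)"
    "map_poly of_int (p * q) = map_poly of_int p * (map_poly of_int q :: complex poly)"
    for p q :: "int poly"
    by (rule poly_eqI, simp add: coeff_map_poly coeff_mult)+
  fix x assume "x \<in> int_adjoin a"
  then show "x \<in> ?R"
    unfolding int_adjoin_def
  proof (induction rule: generate_ring.induct)
    case one
    show ?case by (rule range_eqI[of _ _ 1]) simp
  next
    case (incl h)
    then show ?case by (intro range_eqI[of _ _ "[:0, 1:]"]) (simp add: map_poly_pCons)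
  next
    case (a_inv h)
    then obtain p :: "int poly" where "h = poly (map_poly of_int p) a" by auto
    then show ?case by (intro range_eqI[of _ _ "- p"]) (simp add: hom)
  next
    case (eng_add h1 h2)
    then obtain p q :: "int poly"
      where "h1 = poly (map_poly of_int p) a" "h2 = poly (map_poly of_int q) a" by auto
    then show ?case by (intro range_eqI[of _ _ "p + q"]) (simp add: hom)
  next
    case (eng_mult h1 h2)
    then obtain p q :: "int poly"
      where "h1 = poly (map_poly of_int p) a" "h2 = poly (map_poly of_int q) a" by auto
    then show ?case by (intro range_eqI[of _ _ "p * q"]) (simp add: hom)
  qed
next
  have add: "x + y \<in> int_adjoin a" and mult: "x * y \<in> int_adjoin a"
    if "x \<in> int_adjoin a" "y \<in> int_adjoin a" for x y
    using that generate_ring.eng_add[of x ring_of_type_algebra "{a}" y]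
      generate_ring.eng_mult[of x ring_of_type_algebra "{a}" y]
    by (simp_all add: int_adjoin_def)
  have uminus: "- x \<in> int_adjoin a" if "x \<in> int_adjoin a" for x
    using that generate_ring.a_inv[of x ring_of_type_algebra "{a}"]
    by (simp add: int_adjoin_def)
  have one: "1 \<in> int_adjoin a"
    using generate_ring.one[of ring_of_type_algebra "{a}"] by (simp add: int_adjoin_def)
  have zero: "0 \<in> int_adjoin a"
    using add[OF one uminus[OF one]] by simp
  have nat: "of_nat n \<in> int_adjoin a" for n
    by (induction n) (auto intro: add one zero)
  have int: "of_int k \<in> int_adjoin a" for k
    by (cases k rule: int_cases2) (auto intro: nat uminus)
  have a: "a \<in> int_adjoin a"
    by (simp add: int_adjoin_def generate_ring.incl)
  have "poly (map_poly of_int p) a \<in> int_adjoin a" for p :: "int poly"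
    by (induction p) (auto simp: map_poly_pCons intro: zero int add mult a)
  then show "x \<in> int_adjoin a" if "x \<in> ?R" for x
    using that by auto
qed

end

theory Submission
  imports
    Defs
    "HOL-Computational_Algebra.Field_as_Ring"
    "Jordan_Normal_Form.Char_Poly"
begin

text \<open>
  Suppose \<open>x = \<Sum>k<12. c k * \<alpha> ^ k\<close>, with rational \<open>c k\<close>, is integral over \<open>\<int>\<close>. So are its
  conjugates, obtained by replacing \<open>\<alpha>\<close> with \<open>\<alpha> * w\<close> for a 12th root of unity \<open>w\<close>, and
  Fourier inversion shows that each \<open>12 * c k * \<alpha> ^ k\<close> is integral. Taking 12th powers,
  \<open>(12 * c k) ^ 12 * m ^ k\<close> is an integer, and since \<open>m\<close> is square-free and \<open>k < 12\<close>, so is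
  \<open>12 * c k\<close>. Only the primes 2 and 3 remain to be removed from the denominator. If such a
  prime divides \<open>m\<close>, an Eisenstein argument in powers of \<open>\<alpha>\<close> does this. Otherwise, the
  Fourier argument for the cube (fourth) roots of unity reduces the problem to \<open>y = \<alpha> ^ 3\<close> and
  the prime 2 (\<open>y = \<alpha> ^ 4\<close> and the prime 3), where the Eisenstein argument applies to powers of
  \<open>y - 1\<close> (of \<open>y - m\<close>).
\<close>

section \<open>Algebraic integers form a ring\<close>

text \<open>The hypotheses make \<open>v\<close> a nonzero eigenvector of the integer matrix
  \<open>A\<close>, so \<open>z\<close> is a root of the characteristic polynomial, which is monic
  with integer coefficients. The index set is an arbitrary finite set so that pairs of exponents can
  serve as indices.\<close>

lemma algebraic_int_eigen:
  fixes v :: "'i \<Rightarrow> complex"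
  assumes I: "finite I" "i0 \<in> I" "v i0 \<noteq> 0"
    and ev: "\<And>i. i \<in> I \<Longrightarrow> z * v i = (\<Sum>j\<in>I. of_int (A i j) * v j)"
  shows "algebraic_int z"
proof -
  define N where "N = card I"
  obtain e where e: "bij_betw e {..<N} I"
    using ex_bij_betw_nat_finite[OF I(1)] by (auto simp: N_def atLeast0LessThan)
  define B :: "int mat" where "B = mat N N (\<lambda>(i, j). A (e i) (e j))"
  define w where "w = vec N (\<lambda>i. v (e i))"
  let ?B = "map_mat complex_of_int B"
  have B: "B \<in> carrier_mat N N" by (simp add: B_def)
  have "eigenvector ?B w z"
    unfolding eigenvector_def
  proof (intro conjI)
    obtain k where k: "k < N" "e k = i0"
      using e I(2) by (auto simp: bij_betw_def)
    show "w \<noteq> 0\<^sub>v (dim_row ?B)"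
      using k I(3) by (auto simp: w_def B_def dest!: arg_cong[where f = "\<lambda>x. vec_index x k"])
    show "?B *\<^sub>v w = z \<cdot>\<^sub>v w"
    proof (rule eq_vecI)
      fix i assume "i < dim_vec (z \<cdot>\<^sub>v w)"
      then have i: "i < N" by (simp add: w_def)
      then have "e i \<in> I" using e by (auto simp: bij_betw_def)
      then have "z * v (e i) = (\<Sum>j<N. of_int (A (e i) (e j)) * v (e j))"
        by (simp add: ev sum.reindex_bij_betw[OF e, of "\<lambda>j. of_int (A (e i) j) * v j"])
      then show "vec_index (?B *\<^sub>v w) i = vec_index (z \<cdot>\<^sub>v w) i"
        using i by (simp add: B_def w_def scalar_prod_def atLeast0LessThan)
    qed (simp add: B_def w_def)
  qed (simp add: w_def B_def)
  then have "poly (char_poly ?B) z = 0"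
    using eigenvalue_root_char_poly[of ?B N z] B by (auto simp: eigenvalue_def)
  then have "poly (map_poly of_int (char_poly B)) z = 0"
    by (simp add: of_int_hom.char_poly_hom[OF B])
  then show ?thesis
    using degree_monic_char_poly[OF B] unfolding algebraic_int_altdef_ipoly by auto
qed

text \<open>\<open>S\<close> is the additive group spanned by the products
  \<open>x ^ i * y ^ j\<close> with exponents below the degrees of monic integer equations for
  \<open>x\<close> and \<open>y\<close>. These equations keep \<open>S\<close> stable under both
  numbers, hence under their sum and product, and whatever stabilises \<open>S\<close> acts on the
  generators by an integer matrix.\<close>

lemma algebraic_int_pair_span:
  assumes "algebraic_int x" "algebraic_int y"
  obtains S :: "complex set" where
    "\<And>u. u \<in> S \<Longrightarrow> x * u \<in> S" "\<And>u. u \<in> S \<Longrightarrow> y * u \<in> S"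
    "\<And>u w. u \<in> S \<Longrightarrow> w \<in> S \<Longrightarrow> u + w \<in> S"
    "\<And>z. (\<And>u. u \<in> S \<Longrightarrow> z * u \<in> S) \<Longrightarrow> algebraic_int z"
proof -
  obtain P Q :: "int poly" where P: "poly (of_int_poly P) x = 0" "lead_coeff P = 1"
    and Q: "poly (of_int_poly Q) y = 0" "lead_coeff Q = 1"
    using assms unfolding algebraic_int_altdef_ipoly by auto
  define n m where "n = degree P" and "m = degree Q"
  define I where "I = {..<n} \<times> {..<m}"
  define v where "v = (\<lambda>(i, j). x ^ i * y ^ j)"
  define S where "S = range (\<lambda>a :: nat \<times> nat \<Rightarrow> int. \<Sum>k\<in>I. of_int (a k) * v k)"
  have fin: "finite I" by (simp add: I_def)
  have add: "u + w \<in> S" if uw: "u \<in> S" "w \<in> S" for u w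
  proof -
    obtain a where "u = (\<Sum>k\<in>I. of_int (a k) * v k)"
      using uw(1) unfolding S_def by (rule rangeE)
    moreover obtain b where "w = (\<Sum>k\<in>I. of_int (b k) * v k)"
      using uw(2) unfolding S_def by (rule rangeE)
    ultimately have "u + w = (\<Sum>k\<in>I. of_int (a k + b k) * v k)"
      by (simp add: ring_distribs sum.distrib)
    then show ?thesis unfolding S_def by - (rule range_eqI)
  qed
  have scale: "of_int c * u \<in> S" if u: "u \<in> S" for u c
  proof -
    obtain a where "u = (\<Sum>k\<in>I. of_int (a k) * v k)"
      using u unfolding S_def by (rule rangeE)
    then have "of_int c * u = (\<Sum>k\<in>I. of_int (c * a k) * v k)"
      by (simp add: sum_distrib_left mult.assoc)
    then show ?thesis unfolding S_def by - (rule range_eqI)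
  qed
  have zero: "0 \<in> S"
    unfolding S_def by (rule range_eqI[of _ _ "\<lambda>_. 0"]) simp
  have sum: "sum f A \<in> S" if "\<And>k. k \<in> A \<Longrightarrow> f k \<in> S" for f and A :: "'z set"
    using that by (induction A rule: infinite_finite_induct) (auto intro: zero add)
  have base: "v k \<in> S" if "k \<in> I" for k
  proof -
    have "(\<Sum>l\<in>I. of_int (if l = k then 1 else 0) * v l) = (\<Sum>l\<in>I. if l = k then v l else 0)"
      by (intro sum.cong) auto
    also have "\<dots> = v k" using that fin by simp
    finally show ?thesis unfolding S_def by (intro range_eqI) (rule sym)
  qed
  \<comment> \<open>The monic equation solved for its top power; it rewrites a generator whose
    exponent has just left the allowed range.\<close>
  have red: "r ^ degree R = (\<Sum>i<degree R. of_int (- coeff R i) * r ^ i)"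
    if "poly (of_int_poly R) r = 0" "lead_coeff R = 1" for R and r :: complex
  proof -
    have "0 = (\<Sum>i\<le>degree R. of_int (coeff R i) * r ^ i)"
      using that by (simp add: poly_altdef)
    also have "\<dots> = (\<Sum>i<degree R. of_int (coeff R i) * r ^ i) + r ^ degree R"
      using that(2) by (simp add: lessThan_Suc_atMost[symmetric])
    finally show ?thesis by (simp add: sum_negf eq_neg_iff_add_eq_0 add.commute)
  qed
  have x: "x * v k \<in> S" if k: "k \<in> I" for k
  proof -
    obtain i j where ij: "k = (i, j)" "i < n" "j < m" using k by (auto simp: I_def)
    show ?thesis
    proof (cases "Suc i < n")
      case True
      then have "x * v k = v (Suc i, j)" "(Suc i, j) \<in> I" using ij by (auto simp: v_def I_def)
      then show ?thesis using base by simp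
    next
      case False
      then have "x * v k = x ^ n * y ^ j"
        using ij by (auto simp: v_def mult.assoc[symmetric] not_less_eq less_Suc_eq simp flip: power_Suc)
      also have "\<dots> = (\<Sum>i<n. of_int (- coeff P i) * v (i, j))"
        by (simp only: n_def red[OF P] v_def prod.case sum_distrib_right mult.assoc)
      also have "\<dots> \<in> S"
        by (intro sum scale base) (use ij in \<open>auto simp: I_def\<close>)
      finally show ?thesis .
    qed
  qed
  have y: "y * v k \<in> S" if k: "k \<in> I" for k
  proof -
    obtain i j where ij: "k = (i, j)" "i < n" "j < m" using k by (auto simp: I_def)
    show ?thesis
    proof (cases "Suc j < m")
      case True
      then have "y * v k = v (i, Suc j)" "(i, Suc j) \<in> I" using ij by (auto simp: v_def I_def)
      then show ?thesis using base by simp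
    next
      case False
      then have "m = Suc j" using ij by auto
      then have "y * v k = y ^ m * x ^ i" using ij by (auto simp: v_def)
      also have "\<dots> = (\<Sum>j<m. of_int (- coeff Q j) * v (i, j))"
        by (simp only: m_def red[OF Q] v_def prod.case sum_distrib_right
            mult.assoc mult.commute[of _ "x ^ i"] mult.left_commute[of _ "x ^ i"] sum_distrib_left)
      also have "\<dots> \<in> S"
        by (intro sum scale base) (use ij in \<open>auto simp: I_def\<close>)
      finally show ?thesis .
    qed
  qed
  have ext: "z * u \<in> S" if "\<And>k. k \<in> I \<Longrightarrow> z * v k \<in> S" and u: "u \<in> S" for z u
  proof -
    obtain a where "u = (\<Sum>k\<in>I. of_int (a k) * v k)"
      using u unfolding S_def by (rule rangeE)
    then have "z * u = (\<Sum>k\<in>I. of_int (a k) * (z * v k))"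
      by (simp add: sum_distrib_left mult_ac)
    also have "\<dots> \<in> S" by (intro sum scale that)
    finally show ?thesis .
  qed
  \<comment> \<open>For degree 0, \<open>red\<close> would read 1 = 0. So the generator 1 is
    present, and it is the nonzero entry of the eigenvector.\<close>
  have "n \<noteq> 0" "m \<noteq> 0"
    using red[OF P] red[OF Q] by (intro notI; simp add: n_def m_def)+
  then have I0: "(0, 0) \<in> I" "v (0, 0) \<noteq> 0" by (auto simp: I_def v_def)
  have "algebraic_int z" if z: "\<And>u. u \<in> S \<Longrightarrow> z * u \<in> S" for z
  proof -
    have "\<forall>k\<in>I. \<exists>a :: nat \<times> nat \<Rightarrow> int. z * v k = (\<Sum>l\<in>I. of_int (a l) * v l)"
      using z[OF base] by (auto simp: S_def)
    then obtain A where "\<And>k. k \<in> I \<Longrightarrow> z * v k = (\<Sum>l\<in>I. of_int (A k l) * v l)" by metis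
    from algebraic_int_eigen[OF fin I0 this] show ?thesis .
  qed
  with ext[of x] ext[of y] x y add show ?thesis by (intro that[of S]) auto
qed

lemma algebraic_int_add [intro]:
  fixes x y :: complex
  assumes "algebraic_int x" "algebraic_int y"
  shows "algebraic_int (x + y)"
  by (rule algebraic_int_pair_span[OF assms]) (simp add: ring_distribs)

lemma algebraic_int_mult [intro]:
  fixes x y :: complex
  assumes "algebraic_int x" "algebraic_int y"
  shows "algebraic_int (x * y)"
  by (rule algebraic_int_pair_span[OF assms]) (simp add: mult.assoc)

lemma algebraic_int_diff [intro]:
  fixes x y :: complex
  assumes "algebraic_int x" "algebraic_int y"
  shows "algebraic_int (x - y)"
  using algebraic_int_add[OF assms(1) algebraic_int_minus[OF assms(2)]] by simp

lemma algebraic_int_power [intro]: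
  fixes x :: complex
  shows "algebraic_int x \<Longrightarrow> algebraic_int (x ^ n)"
  by (induction n) auto

lemma algebraic_int_sum [intro]:
  fixes f :: "'a \<Rightarrow> complex"
  shows "(\<And>k. k \<in> A \<Longrightarrow> algebraic_int (f k)) \<Longrightarrow> algebraic_int (sum f A)"
  by (induction A rule: infinite_finite_induct) auto

section \<open>Integrality of roots and quotients\<close>

lemma algebraic_int_power_imp:
  fixes x :: complex
  assumes "algebraic_int (x ^ n)" "n > 0"
  shows "algebraic_int x"
  using algebraic_int_root[OF assms(1), of "monom 1 n" x] assms(2)
  by (auto simp: poly_monom degree_monom_eq)

text \<open>A rational algebraic integer is an integer. Non-integrality claims below are reduced to
  this case.\<close>

lemma algebraic_int_of_int_divide_iff:
  assumes "b \<noteq> 0"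
  shows "algebraic_int (of_int a / of_int b :: complex) \<longleftrightarrow> b dvd a"
proof
  assume "algebraic_int (of_int a / of_int b :: complex)"
  then have "(of_int a / of_int b :: complex) \<in> \<int>"
    by (rule rational_algebraic_int_is_int) auto
  then obtain c where "of_int a / of_int b = (of_int c :: complex)" by (auto elim: Ints_cases)
  with assms have "of_int a = (of_int (c * b) :: complex)" by (simp add: field_simps)
  then have "a = c * b" by (simp only: of_int_eq_iff)
  then show "b dvd a" by simp
next
  assume "b dvd a"
  then obtain c where "a = b * c" by (elim dvdE)
  with assms show "algebraic_int (of_int a / of_int b :: complex)" by simp
qed

lemma algebraic_int_of_int_mult_dvd:
  fixes x :: complex
  assumes "algebraic_int x" "d dvd c"
  shows "algebraic_int (of_int c * x / of_int d)"
proof (cases "d = 0")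
  case False
  with assms(2) obtain e where "c = d * e" by (elim dvdE)
  with False assms(1) show ?thesis by auto
qed simp

text \<open>If \<open>u * a + w * p = 1\<close>, then \<open>x / p\<close> is \<open>u\<close> times
  \<open>a * x / p\<close> plus \<open>w * x\<close>.\<close>

lemma algebraic_int_divide_coprime:
  fixes x :: complex
  assumes "algebraic_int x" "algebraic_int (of_int a * x / of_int p)" "coprime a p" "p \<noteq> 0"
  shows "algebraic_int (x / of_int p)"
proof -
  obtain u w where "u * a + w * p = 1"
    using assms(3) by (metis bezout_int coprime_imp_gcd_eq_1)
  then have uw: "of_int u * of_int a + of_int w * of_int p = (1 :: complex)"
    by (metis of_int_1 of_int_add of_int_mult)
  have "x / of_int p = (of_int u * of_int a + of_int w * of_int p) * (x / of_int p)"
    by (simp add: uw)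
  also have "\<dots> = of_int u * (of_int a * x / of_int p) + of_int w * x"
    using assms(4) by (simp add: field_simps)
  also have "algebraic_int \<dots>"
    using assms(1,2) by (intro algebraic_int_add algebraic_int_mult algebraic_int_of_int)
  finally show ?thesis .
qed

section \<open>Eisenstein arguments at a single prime\<close>

text \<open>After multiplication of the sum by \<open>t ^ (n - 1 - k)\<close>, the terms below
  \<open>k\<close> are integral by induction and those above \<open>k\<close> contain
  \<open>t ^ n\<close>, a multiple of \<open>p\<close>. So \<open>b k * t ^ (n - 1) / p\<close> is
  integral; were \<open>b k\<close> prime to \<open>p\<close>, then \<open>t ^ (n - 1) / p\<close>
  would be integral too, and its \<open>n\<close>-th power is \<open>v ^ (n - 1) / p\<close>. The
  hypothesis \<open>not\<close> plays the part of the classical condition that the square of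
  \<open>p\<close> does not divide the constant term, for a \<open>v\<close> that may be
  irrational.\<close>

lemma eisenstein_coeffs_dvd:
  fixes t v :: complex and p :: int and b :: "nat \<Rightarrow> int"
  assumes "prime p" and t: "algebraic_int t" and v: "algebraic_int v"
    and tv: "t ^ n = of_int p * v"
    and not: "\<not> algebraic_int (v ^ (n - 1) / of_int p)"
    and int: "algebraic_int ((\<Sum>k<n. of_int (b k) * t ^ k) / of_int p)"
    and "k < n"
  shows "p dvd b k"
  using \<open>k < n\<close>
proof (induction k rule: less_induct)
  case (less k)
  have p: "p \<noteq> 0" using \<open>prime p\<close> by auto
  define s where "s = n - 1 - k"
  have split: "{..<n} = {..<k} \<union> {k} \<union> {k<..<n}" using less.prems by auto
  have "(\<Sum>j<n. of_int (b j) * t ^ j) / of_int p * t ^ s =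
      (\<Sum>j<n. of_int (b j) * t ^ (j + s) / of_int p)"
    by (simp add: sum_divide_distrib sum_distrib_right power_add mult.assoc)
  also have "\<dots> = (\<Sum>j<k. of_int (b j) * t ^ (j + s) / of_int p) + of_int (b k) * t ^ (k + s) / of_int p +
     (\<Sum>j\<in>{k<..<n}. of_int (b j) * t ^ (j + s) / of_int p)"
    unfolding split by (subst sum.union_disjoint; auto)+
  finally have *: "of_int (b k) * t ^ (n - 1) / of_int p =
      (\<Sum>j<n. of_int (b j) * t ^ j) / of_int p * t ^ s
      - (\<Sum>j<k. of_int (b j) * t ^ (j + s) / of_int p)
      - (\<Sum>j\<in>{k<..<n}. of_int (b j) * t ^ (j + s) / of_int p)"
    using less.prems by (simp add: s_def)
  have "algebraic_int (of_int (b j) * t ^ (j + s) / of_int p)" if "j < k" for j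
    using that less t by (intro algebraic_int_of_int_mult_dvd) auto
  moreover have "algebraic_int (of_int (b j) * t ^ (j + s) / of_int p)" if "k < j" for j
  proof -
    have "j + s = n + (j - k - 1)" using that less.prems by (simp add: s_def)
    then have "of_int (b j) * t ^ (j + s) / of_int p = of_int (b j) * (v * t ^ (j - k - 1))"
      using p by (simp add: power_add tv)
    then show ?thesis using t v by auto
  qed
  ultimately have "algebraic_int (of_int (b k) * t ^ (n - 1) / of_int p)"
    unfolding * by (intro algebraic_int_diff algebraic_int_mult algebraic_int_sum
        int algebraic_int_power t) auto
  moreover have "\<not> algebraic_int (t ^ (n - 1) / of_int p)"
  proof
    assume "algebraic_int (t ^ (n - 1) / of_int p)"
    then have "algebraic_int ((t ^ (n - 1) / of_int p) ^ n)" by blast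
    also have "(t ^ (n - 1) / of_int p) ^ n = (t ^ n) ^ (n - 1) / of_int p ^ n"
      by (simp add: power_divide mult.commute flip: power_mult)
    also have "\<dots> = (of_int p * v) ^ (n - 1) / of_int p ^ n"
      by (simp only: tv)
    also have "\<dots> = v ^ (n - 1) / of_int p"
      using p less.prems by (cases n) (simp_all add: power_mult_distrib)
    finally show False using not by simp
  qed
  ultimately have "\<not> coprime (b k) p"
    using algebraic_int_divide_coprime[of "t ^ (n - 1)" "b k" p] t p by blast
  then show "p dvd b k"
    using \<open>prime p\<close> by (metis coprime_commute prime_imp_coprime)
qed

lemma quartic_coeffs_even:
  fixes y :: complex and m :: int and b :: "nat \<Rightarrow> int"
  assumes y: "y ^ 4 = of_int m" and m: "[m = 3] (mod 4)"
    and int: "algebraic_int ((\<Sum>k<4. of_int (b k) * y ^ k) / 2)"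
    and "k < 4"
  shows "even (b k)"
proof -
  have yi: "algebraic_int y" by (rule algebraic_int_power_imp[of _ 4]) (simp_all add: y)
  \<comment> \<open>Then \<open>y ^ 4 + 1\<close> is \<open>4 * l\<close>, so every term in the
    expansion of \<open>(y - 1) ^ 4\<close> becomes even.\<close>
  obtain l where l: "m = 4 * l - 1"
  proof -
    have "4 dvd m + 1" using m by (simp add: cong_def) presburger
    then show ?thesis using that by (elim dvdE) (simp add: eq_diff_eq)
  qed
  \<comment> \<open>In terms of \<open>t\<close>, the prime 2 behaves as in an Eisenstein polynomial:
    \<open>t\<^sup>4 = 2 v\<close> with \<open>v\<close> congruent to \<open>y\<^sup>2\<close> modulo 2. The \<open>c k\<close> are the coefficients
    with respect to powers of \<open>t\<close>.\<close>
  define s where "s = of_int l - y ^ 3 + y ^ 2 - y"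
  define v where "v = y ^ 2 + 2 * s"
  define t where "t = y - 1"
  define c where "c k = (if k = 0 then b 0 + b 1 + b 2 + b 3 else if k = 1 then b 1 + 2 * b 2 + 3 * b 3
     else if k = 2 then b 2 + 3 * b 3 else b 3)" for k :: nat
  have s: "algebraic_int s"
    unfolding s_def using yi by (intro algebraic_int_diff algebraic_int_add algebraic_int_power) auto
  have tv: "t ^ 4 = of_int 2 * v"
  proof -
    have "t ^ 4 = y ^ 4 + 1 - 4 * y ^ 3 + 6 * y\<^sup>2 - 4 * y"
      by (simp add: t_def eval_nat_numeral algebra_simps)
    also have "\<dots> = of_int 2 * v" by (simp add: y l v_def s_def algebra_simps)
    finally show ?thesis .
  qed
  have "2 dvd c k" if "k < 4" for k
  proof (rule eisenstein_coeffs_dvd[OF _ _ _ tv _ _ that])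
    show "algebraic_int t" "algebraic_int v" using yi s by (auto simp: t_def v_def)
    have "(\<Sum>k<4. of_int (c k) * t ^ k) = (\<Sum>k<4. of_int (b k) * y ^ k)"
      by (simp add: eval_nat_numeral c_def t_def algebra_simps)
    then show "algebraic_int ((\<Sum>k<4. of_int (c k) * t ^ k) / of_int 2)" using int by simp
    show "\<not> algebraic_int (v ^ (4 - 1) / of_int 2)"
    proof
      assume "algebraic_int (v ^ (4 - 1) / of_int 2)"
      \<comment> \<open>The subtracted terms are those of the expansion of
        \<open>(y ^ 2 + 2 * s) ^ 3 / 2\<close> other than \<open>y ^ 6 / 2\<close>. Squaring this
        remainder gives the rational number \<open>m ^ 3 / 4\<close>, although \<open>m\<close> is
        odd.\<close>
      then have "algebraic_int (v ^ 3 / 2 - (3 * (y ^ 4 * s) + 6 * (y ^ 2 * s ^ 2) + 4 * s ^ 3))"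
        using yi s by (intro algebraic_int_diff algebraic_int_add algebraic_int_mult algebraic_int_power) auto
      also have "v ^ 3 / 2 - (3 * (y ^ 4 * s) + 6 * (y ^ 2 * s ^ 2) + 4 * s ^ 3) = y ^ 6 / 2"
        by (simp add: v_def power2_eq_square power3_eq_cube eval_nat_numeral algebra_simps add_divide_distrib)
      finally have "algebraic_int ((y ^ 6 / 2) ^ 2)" by (rule algebraic_int_power)
      also have "(y ^ 6 / 2) ^ 2 = (y ^ 4) ^ 3 / 4" by (simp add: power_divide flip: power_mult)
      also have "\<dots> = of_int (m ^ 3) / of_int 4" by (simp add: y)
      finally have "4 dvd m ^ 3" by (subst (asm) algebraic_int_of_int_divide_iff) auto
      then have "even (m ^ 3)" using dvd_trans[of 2 4 "m ^ 3"] by simp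
      then show False by (simp add: l)
    qed
  qed simp
  \<comment> \<open>Passing from \<open>b\<close> to \<open>c\<close> is unitriangular, so evenness
    carries back from \<open>c\<close> to \<open>b\<close>, starting at index 3.\<close>
  then have "2 dvd c 0" "2 dvd c 1" "2 dvd c 2" "2 dvd c 3" by auto
  then have "even (b 0)" "even (b 1)" "even (b 2)" "even (b 3)" by (simp_all add: c_def)
  then show ?thesis using \<open>k < 4\<close> by (auto simp: less_Suc_eq eval_nat_numeral)
qed

text \<open>Divisibility by 3 is Fermat's little theorem; the remaining residues 2, 4, 5, 7 modulo 9
  give 3 or 6, never 0. The number \<open>m - m ^ 3\<close> is what remains of
  \<open>(y - m) ^ 3\<close> modulo \<open>3 * (y - m)\<close> when
  \<open>y ^ 3 = m\<close>.\<close>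

lemma int_minus_cube_mod_9:
  fixes m :: int
  assumes "\<not> 3 dvd m" "\<not> [m = 1] (mod 9)" "\<not> [m = -1] (mod 9)"
  obtains w where "m - m ^ 3 = 3 * w" "\<not> 3 dvd w"
proof -
  define d where "d = m - m ^ 3"
  have "m mod 9 \<noteq> 1" "m mod 9 \<noteq> 8" "m mod 3 \<noteq> 0"
    using assms by (auto simp: cong_def dvd_eq_mod_eq_0)
  then have "m mod 9 = 2 \<or> m mod 9 = 4 \<or> m mod 9 = 5 \<or> m mod 9 = 7"
    by presburger
  moreover have "[m = m mod 9] (mod 9)"
    by (simp add: cong_def)
  then have "[d = m mod 9 - (m mod 9) ^ 3] (mod 9)"
    unfolding d_def by (intro cong_diff cong_pow)
  then have eq: "d mod 9 = (m mod 9 - (m mod 9) ^ 3) mod 9"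
    by (simp only: cong_def)
  ultimately have "d mod 9 = 3 \<or> d mod 9 = 6"
    by (elim disjE) (simp_all add: eq del: mod_diff_left_eq mod_diff_right_eq mod_diff_eq)
  then have "d = 3 * (d div 3)" "\<not> 3 dvd d div 3"
    by presburger+
  then show ?thesis unfolding d_def by (rule that)
qed

lemma cubic_coeffs_dvd_3:
  fixes y :: complex and m :: int and b :: "nat \<Rightarrow> int"
  assumes y: "y ^ 3 = of_int m" and m: "\<not> 3 dvd m" "\<not> [m = 1] (mod 9)" "\<not> [m = -1] (mod 9)"
    and int: "algebraic_int ((\<Sum>k<3. of_int (b k) * y ^ k) / 3)"
    and "k < 3"
  shows "3 dvd b k"
proof -
  have yi: "algebraic_int y" by (rule algebraic_int_power_imp[of _ 3]) (simp_all add: y)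
  obtain w where w: "m - m ^ 3 = 3 * w" "\<not> 3 dvd w"
    by (rule int_minus_cube_mod_9[OF m])
  \<comment> \<open>The non-congruences modulo 9 make \<open>t\<^sup>3 = 3 v\<close> with \<open>v\<close> coprime to 3.\<close>
  define t where "t = y - of_int m"
  define u where "u = of_int m * y * t"
  define v where "v = of_int w - u"
  define c where "c k = (if k = 0 then b 0 + m * b 1 + m ^ 2 * b 2
     else if k = 1 then b 1 + 2 * m * b 2 else b 2)" for k :: nat
  have ti: "algebraic_int t" using yi by (auto simp: t_def)
  have ui: "algebraic_int u" using yi ti by (auto simp: u_def)
  have vi: "algebraic_int v" using ui by (auto simp: v_def)
  have tv: "t ^ 3 = of_int 3 * v"
  proof -
    \<comment> \<open>The identity \<open>(y - m) ^ 3 = y ^ 3 - m ^ 3 - 3 * m * y * (y - m)\<close>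
      explains the choice of \<open>u\<close>.\<close>
    have "t ^ 3 = y ^ 3 - of_int m ^ 3 - 3 * u"
      by (simp add: u_def t_def eval_nat_numeral algebra_simps)
    also have "y ^ 3 - of_int m ^ 3 = of_int (m - m ^ 3)" by (simp add: y)
    also have "\<dots> = 3 * of_int w" unfolding w(1) by simp
    also have "\<dots> - 3 * u = of_int 3 * v" by (simp add: v_def)
    finally show ?thesis .
  qed
  have "3 dvd c k" if "k < 3" for k
  proof (rule eisenstein_coeffs_dvd[OF _ ti vi tv _ _ that])
    have "(\<Sum>k<3. of_int (c k) * t ^ k) = (\<Sum>k<3. of_int (b k) * y ^ k)"
      by (simp add: eval_nat_numeral c_def t_def algebra_simps)
    then show "algebraic_int ((\<Sum>k<3. of_int (c k) * t ^ k) / of_int 3)" using int by simp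
    show "\<not> algebraic_int (v ^ (3 - 1) / of_int 3)"
    proof
      assume "algebraic_int (v ^ (3 - 1) / of_int 3)"
      \<comment> \<open>From \<open>v = w - u\<close> follows
        \<open>w ^ 3 = v ^ 3 + u ^ 3 + 3 * w * u * v\<close>. Here \<open>u ^ 3 / 3\<close> is
        integral because \<open>u\<close> contains the factor \<open>t\<close> and
        \<open>t ^ 3 = 3 * v\<close>; hence 3 would divide \<open>w ^ 3\<close>.\<close>
      then have "algebraic_int ((v ^ 2 / 3) * v + of_int m ^ 3 * y ^ 3 * v + of_int w * u * v)"
        using yi ui vi by (intro algebraic_int_add algebraic_int_mult algebraic_int_power) auto
      also have "of_int m ^ 3 * y ^ 3 * v = u ^ 3 / 3"
        using tv by (simp add: u_def power_mult_distrib)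
      also have "(v ^ 2 / 3) * v + u ^ 3 / 3 + of_int w * u * v = of_int (w ^ 3) / of_int 3"
        by (simp add: v_def eval_nat_numeral algebra_simps add_divide_distrib diff_divide_distrib)
      finally have "3 dvd w ^ 3" by (subst (asm) algebraic_int_of_int_divide_iff) auto
      then have "3 dvd w" by (rule prime_dvd_power[rotated]) simp
      then show False using w by simp
    qed
  qed simp
  then have c: "3 dvd c 0" "3 dvd c 1" "3 dvd c 2" by auto
  \<comment> \<open>The change of coefficients is again unitriangular and is solved from the top
    index down.\<close>
  then have "3 dvd b 2" by (simp add: c_def)
  moreover from this c(2) have "3 dvd b 1" by (simp add: c_def dvd_add_left_iff)
  moreover from calculation c(1) have "3 dvd b 0" by (simp add: c_def dvd_add_left_iff)
  ultimately show ?thesis using \<open>k < 3\<close> by (auto simp: less_Suc_eq eval_nat_numeral)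
qed

section \<open>Denominators and roots of unity\<close>

interpretation of_rat_poly_hom: map_poly_idom_hom "of_rat :: rat \<Rightarrow> complex" ..

lemma rat_poly_clear_denominators:
  fixes r :: "rat poly"
  obtains d :: int and s :: "int poly" where "d \<noteq> 0" "of_int_poly s = smult (of_int d) r"
proof -
  have "\<exists>d (s :: int poly). d \<noteq> 0 \<and> of_int_poly s = smult (of_int d) r"
  proof (induction r)
    case 0
    show ?case by (intro exI[of _ 1] exI[of _ 0]) simp
  next
    case (pCons a r)
    then obtain d and s :: "int poly" where ds: "d \<noteq> 0" "of_int_poly s = smult (of_int d) r"
      by blast
    obtain x y where xy: "a = of_int x / of_int y" "y > 0"
      by (metis quotient_of_denom_pos quotient_of_div surj_pair)
    show ?case
      using ds(1) xy
      by (intro exI[of _ "d * y"] exI[of _ "pCons (d * x) (smult y s)"])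
         (simp add: of_int_hom.map_poly_hom_smult of_int_hom.map_poly_pCons_hom ds(2) mult.commute)
  qed
  with that show thesis by blast
qed

text \<open>The exact order makes the geometric sums of the Fourier inversion vanish off the
  multiples of \<open>n\<close>.\<close>

lemma primitive_root_of_unity_exists:
  assumes "n > 0"
  obtains w :: complex where "w ^ n = 1" "\<And>j. w ^ j = 1 \<longleftrightarrow> n dvd j"
proof -
  define w where "w = cis (2 * pi / n)"
  have pow: "w ^ j = cis (2 * pi * j / n)" for j
    by (simp add: w_def DeMoivre mult.commute)
  have w: "w ^ n = 1" using assms by (simp add: pow)
  have "w ^ j = 1 \<longleftrightarrow> n dvd j" for j
  proof
    assume "w ^ j = 1"
    have "w ^ j = w ^ (n * (j div n) + j mod n)" by simp
    also have "\<dots> = w ^ (j mod n)" unfolding power_add power_mult w by simp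
    finally have "cis (2 * pi * real (j mod n) / real n) = cis (2 * pi * real 0 / real n)"
      using \<open>w ^ j = 1\<close> by (simp add: pow)
    then have "j mod n = 0"
      by (rule inj_onD[OF bij_betw_imp_inj_on[OF bij_betw_roots_unity[OF assms]]]) (use assms in auto)
    then show "n dvd j" by auto
  qed (use w in \<open>auto simp: power_mult elim!: dvdE\<close>)
  with w that show thesis by blast
qed

text \<open>In lowest terms \<open>a / b\<close>, the hypothesis gives
  \<open>b ^ n dvd m ^ k\<close>. A prime factor of \<open>b\<close> divides the square-free
  \<open>m\<close> exactly once, hence occurs in \<open>m ^ k\<close> only \<open>k\<close> times,
  which is fewer than \<open>n\<close>.\<close>

lemma rational_Ints_if_power_mult_Ints:
  fixes r :: rat and m :: int
  assumes "squarefree m" "k < n" "r ^ n * of_int m ^ k \<in> \<int>"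
  shows "r \<in> \<int>"
proof -
  obtain a b where ab: "r = of_int a / of_int b" "b > 0" "coprime a b"
    by (metis quotient_of_coprime quotient_of_denom_pos quotient_of_div surj_pair)
  obtain N where "r ^ n * of_int m ^ k = of_int N" using assms(3) by (auto elim: Ints_cases)
  moreover have "of_int a = r * of_int b" using ab(1,2) by simp
  ultimately have "of_int (a ^ n * m ^ k) = (of_int (N * b ^ n) :: rat)"
    by (simp add: power_mult_distrib mult_ac)
  then have "a ^ n * m ^ k = N * b ^ n" by (simp only: of_int_eq_iff)
  then have "b ^ n dvd a ^ n * m ^ k" by simp
  with ab(3) have dvd: "b ^ n dvd m ^ k"
    by (simp add: coprime_commute coprime_dvd_mult_right_iff)
  have "b = 1"
  proof (rule ccontr)
    assume "b \<noteq> 1"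
    with ab(2) have "\<not> is_unit b" by simp
    then obtain q where q: "prime q" "q dvd b"
      using ab(2) prime_divisor_exists[of b] by auto
    then have qm: "q ^ n dvd m ^ k" using dvd by (meson dvd_power_same dvd_trans)
    then have "q dvd m ^ k" using dvd_trans[OF dvd_power[of n q] qm] \<open>k < n\<close> by simp
    then have "q dvd m" using q(1) by (rule prime_dvd_power[rotated])
    then obtain c where c: "m = q * c" by (elim dvdE)
    have "\<not> q dvd c"
      using assms(1) q(1) by (auto simp: c squarefree_def power2_eq_square)
    have "q ^ Suc k dvd q ^ k * c ^ k"
      using qm \<open>k < n\<close> by (metis c power_mult_distrib Suc_leI dvd_trans le_imp_power_dvd)
    then have "q dvd c ^ k" using q(1) by (simp add: mult.commute[of q])
    then show False using q(1) \<open>\<not> q dvd c\<close> prime_dvd_power by blast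
  qed
  with ab show ?thesis by simp
qed

section \<open>The field \<rat>(\<alpha>) and its power basis\<close>

locale pure_degree_12 =
  fixes m :: int and \<alpha> :: complex
  assumes squarefree: "squarefree m" and not_unit: "m \<noteq> 1" "m \<noteq> -1"
    and root: "\<alpha> ^ 12 = of_int m"
begin

abbreviation eval :: "rat poly \<Rightarrow> complex" where
  "eval g \<equiv> poly (map_poly of_rat g) \<alpha>"

definition F :: "rat poly" where
  "F = monom 1 12 - [:of_int m:]"

lemma algebraic_int_\<alpha>: "algebraic_int \<alpha>"
  by (rule algebraic_int_power_imp[of _ 12]) (simp_all add: root)

lemma m_nonzero: "m \<noteq> 0"
proof
  assume "m = 0"
  then have "2 dvd (1 :: int)" by (intro squarefreeD[OF squarefree]) simp
  then show False by simp
qed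

lemma not_prime_square_dvd: "prime p \<Longrightarrow> \<not> p * p dvd m" for p :: int
  using squarefreeD[OF squarefree, of p] not_prime_unit[of p] unfolding power2_eq_square by blast

text \<open>The Eisenstein argument applies to \<alpha> itself: the cofactor \<open>c\<close> of
  \<open>p\<close> in \<open>m\<close> is prime to \<open>p\<close> because \<open>m\<close> is
  square-free.\<close>

lemma coeffs_dvd_if_prime_dvd:
  fixes b :: "nat \<Rightarrow> int"
  assumes "prime p" "p dvd m"
    and "algebraic_int ((\<Sum>k<12. of_int (b k) * \<alpha> ^ k) / of_int p)" "k < 12"
  shows "p dvd b k"
proof -
  obtain c where c: "m = p * c" using assms(2) by (elim dvdE)
  show ?thesis
  proof (rule eisenstein_coeffs_dvd[OF assms(1) algebraic_int_\<alpha> _ _ _ assms(3,4)])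
    show "\<alpha> ^ 12 = of_int p * of_int c" by (simp add: root c)
    show "\<not> algebraic_int (of_int c ^ (12 - 1) / of_int p :: complex)"
    proof
      assume "algebraic_int (of_int c ^ (12 - 1) / of_int p :: complex)"
      then have "algebraic_int (of_int (c ^ 11) / of_int p :: complex)" by simp
      then have "p dvd c ^ 11"
        using assms(1) by (subst (asm) algebraic_int_of_int_divide_iff) auto
      then have "p dvd c" using assms(1) by (rule prime_dvd_power[rotated])
      then show False using not_prime_square_dvd[OF assms(1)] c by simp
    qed
  qed simp
qed

lemma eval_eq_sum: "degree g < 12 \<Longrightarrow> eval g = (\<Sum>k<12. of_rat (coeff g k) * \<alpha> ^ k)"
  unfolding poly_altdef by (rule sum.mono_neutral_cong_left) (auto simp: coeff_eq_0)

lemma eval_of_int: "eval (of_int_poly p) = poly (of_int_poly p) \<alpha>"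
  by (simp add: map_poly_map_poly o_def)

text \<open>Linear independence of the first 12 powers of \<alpha>, which makes \<open>F\<close> the
  minimal polynomial. A relation can be scaled to a primitive integer polynomial. For a prime
  \<open>q\<close> dividing \<open>m\<close>, the value 0 divided by \<open>q\<close> is integral,
  so \<open>q\<close> divides every coefficient, against primitivity.\<close>

lemma eval_eq_0_imp_eq_0:
  assumes "degree r < 12" "eval r = 0"
  shows "r = 0"
proof (rule ccontr)
  assume "r \<noteq> 0"
  obtain d and s :: "int poly" where ds: "d \<noteq> 0" "of_int_poly s = smult (of_int d) r"
    by (rule rat_poly_clear_denominators)
  have "s \<noteq> 0" using ds \<open>r \<noteq> 0\<close> by auto
  define t where "t = primitive_part s"
  have st: "s = smult (content s) t" by (simp add: t_def)
  have "degree s = degree (of_int_poly s :: rat poly)" by simp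
  also have "\<dots> = degree r" using ds by simp
  finally have deg: "degree t < 12" using assms(1) by (simp add: t_def)
  have "poly (of_int_poly s) \<alpha> = eval (of_int_poly s)" by (simp only: eval_of_int)
  also have "\<dots> = 0" by (simp add: ds(2) of_rat_hom.map_poly_hom_smult assms(2))
  finally have "of_int (content s) * poly (of_int_poly t) \<alpha> = 0"
    by (subst (asm) st) (simp add: of_int_hom.map_poly_hom_smult)
  then have "eval (of_int_poly t) = 0" using \<open>s \<noteq> 0\<close> by (simp add: eval_of_int)
  then have 0: "(\<Sum>k<12. of_int (coeff t k) * \<alpha> ^ k) = 0"
    using deg by (subst (asm) eval_eq_sum) simp_all
  have "\<not> is_unit m" using not_unit by simp
  then obtain q where q: "prime q" "q dvd m"
    using m_nonzero prime_divisor_exists[of m] by auto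
  have "q dvd coeff t k" for k
  proof (cases "k < 12")
    case True
    then show ?thesis using coeffs_dvd_if_prime_dvd[OF q, of "coeff t"] 0 by simp
  next
    case False
    then show ?thesis using deg by (simp add: coeff_eq_0)
  qed
  then have "q dvd content t" by (simp flip: const_poly_dvd_iff_dvd_content add: const_poly_dvd_iff)
  then have "is_unit q" using \<open>s \<noteq> 0\<close> by (simp add: t_def)
  then show False using q(1) not_prime_unit by blast
qed

lemma degree_F: "degree F = 12"
  unfolding F_def diff_conv_add_uminus
  by (subst degree_add_eq_left) (simp_all add: degree_monom_eq)

lemma poly_F: "poly (map_poly of_rat F) x = x ^ 12 - of_int m" for x :: complex
  by (simp add: F_def of_rat_poly_hom.hom_minus poly_monom of_rat_hom.map_poly_pCons_hom)

lemma eval_mult: "eval (g * h) = eval g * eval h"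
  by (simp add: of_rat_poly_hom.hom_mult)

lemma eval_add: "eval (g + h) = eval g + eval h"
  by (simp add: of_rat_poly_hom.hom_add)

lemma eval_mod_F: "eval (h mod F) = eval h"
proof -
  have "eval h = eval (h div F * F + h mod F)" by simp
  also have "\<dots> = eval (h mod F)"
    unfolding eval_add eval_mult poly_F by (simp add: root)
  finally show ?thesis ..
qed

lemma degree_mod_F: "degree (h mod F) < 12"
  using degree_mod_less[of F h] degree_F by (cases "F = 0"; cases "h mod F = 0") auto

lemma F_dvd_if_eval_eq_0:
  assumes "eval h = 0"
  shows "F dvd h"
  using eval_eq_0_imp_eq_0[OF degree_mod_F, of h] assms by (simp add: eval_mod_F dvd_eq_mod_eq_0)

text \<open>The gcd of \<open>g\<close> and \<open>F\<close> does not vanish at \<alpha>, so the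
  cofactor \<open>e\<close> does and is a multiple of \<open>F\<close>. By degrees the gcd is
  constant, and a Bezout identity gives the inverse.\<close>

lemma eval_inverse:
  assumes "eval g \<noteq> 0"
  obtains h where "eval h = inverse (eval g)"
proof -
  obtain e where e: "F = gcd g F * e" by (metis dvdE gcd_dvd2)
  obtain g' where g': "g = gcd g F * g'" by (metis dvdE gcd_dvd1)
  have "eval (gcd g F) \<noteq> 0" using assms eval_mult[of "gcd g F" g'] g' by auto
  moreover have "eval F = 0" by (simp add: poly_F root)
  ultimately have "eval e = 0" using eval_mult[of "gcd g F" e] e by auto
  then have "F dvd e" by (rule F_dvd_if_eval_eq_0)
  moreover have "F \<noteq> 0" using degree_F by auto
  ultimately have "degree (gcd g F) = 0"
    using e degree_mult_eq[of "gcd g F" e] dvd_imp_degree_le[of F e]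
    by (metis add_cancel_left_left add_le_same_cancel2 le_zero_eq mult_zero_left mult_zero_right)
  then have "is_unit (gcd g F)" using \<open>F \<noteq> 0\<close> by (simp add: is_unit_iff_degree)
  then have "coprime g F" by (rule is_unit_gcd[THEN iffD1])
  then have "gcd g F = 1" by (rule coprime_imp_gcd_eq_1)
  define u w where "u = fst (bezout_coefficients g F)" and "w = snd (bezout_coefficients g F)"
  have "u * g + w * F = 1"
    unfolding u_def w_def by (simp only: bezout_coefficients_fst_snd \<open>gcd g F = 1\<close>)
  then have "eval (u * g + w * F) = 1" by simp
  then have "eval u * eval g = 1" unfolding eval_add eval_mult poly_F by (simp add: root)
  then have "eval u = inverse (eval g)" using assms by (simp add: field_simps)
  then show thesis by (rule that)
qed

lemma rat_adjoin_subset: "rat_adjoin \<alpha> \<subseteq> range eval"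
proof
  fix x assume "x \<in> rat_adjoin \<alpha>"
  then show "x \<in> range eval"
    unfolding rat_adjoin_def
  proof (induction rule: generate_field.induct)
    case one
    show ?case by (rule range_eqI[of _ _ 1]) simp
  next
    case (incl h)
    then show ?case by (intro range_eqI[of _ _ "[:0, 1:]"]) simp
  next
    case (a_inv h)
    then obtain p where "h = eval p" by auto
    then show ?case by (intro range_eqI[of _ _ "- p"]) (simp add: of_rat_poly_hom.hom_uminus)
  next
    case (m_inv h)
    then obtain p where p: "h = eval p" by auto
    with m_inv eval_inverse[of p] obtain q where "eval q = inverse h" by auto
    with m_inv show ?case by (intro range_eqI[of _ _ q]) simp
  next
    case (eng_add h1 h2)
    then obtain p q where "h1 = eval p" "h2 = eval q" by auto
    then show ?case by (intro range_eqI[of _ _ "p + q"]) (simp add: eval_add)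
  next
    case (eng_mult h1 h2)
    then obtain p q where "h1 = eval p" "h2 = eval q" by auto
    then show ?case by (intro range_eqI[of _ _ "p * q"]) (simp add: eval_mult)
  qed
qed

section \<open>Conjugates, Fourier inversion and the bound 12 for denominators\<close>

text \<open>If a monic integer \<open>P\<close> kills the value of \<open>g\<close> at \<alpha>,
  then \<open>F\<close> divides the composition of \<open>P\<close> with \<open>g\<close>, and
  \<open>F\<close> also vanishes at \<open>\<alpha> * w\<close>.\<close>

lemma algebraic_int_conjugate:
  assumes "algebraic_int (eval g)" "w ^ 12 = 1"
  shows "algebraic_int (poly (map_poly of_rat g) (\<alpha> * w))"
proof -
  obtain P :: "int poly" where P: "poly (of_int_poly P) (eval g) = 0" "lead_coeff P = 1"
    using assms(1) unfolding algebraic_int_altdef_ipoly by auto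
  define h where "h = pcompose (of_int_poly P) g"
  have h: "poly (map_poly of_rat h) x = poly (of_int_poly P) (poly (map_poly of_rat g) x)" for x :: complex
    by (simp add: h_def of_rat_hom.map_poly_pcompose poly_pcompose map_poly_map_poly o_def)
  then have "F dvd h" using P(1) by (intro F_dvd_if_eval_eq_0) simp
  then obtain e where "h = F * e" by (elim dvdE)
  then have "poly (map_poly of_rat h) (\<alpha> * w) = 0"
    by (simp add: of_rat_poly_hom.hom_mult poly_F power_mult_distrib root assms(2))
  with P(2) show ?thesis unfolding h algebraic_int_altdef_ipoly by auto
qed

text \<open>For \<open>w\<close> of exact order \<open>n\<close>, the conjugates at
  \<open>\<alpha> * w ^ j\<close> are added with weights \<open>w ^ ((n - i) * j)\<close>. Only
  exponents congruent to \<open>i\<close> modulo \<open>n\<close> survive, each with the factor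
  \<open>n\<close>.\<close>

lemma algebraic_int_trace:
  assumes int: "algebraic_int (eval g)" and g: "degree g < 12" and n: "n dvd 12" "i < n"
  shows "algebraic_int (of_nat n * (\<Sum>k | k < 12 \<and> k mod n = i. of_rat (coeff g k) * \<alpha> ^ k))"
proof -
  have "n > 0" using n by simp
  then obtain w :: complex where w: "w ^ n = 1" "\<And>j. w ^ j = 1 \<longleftrightarrow> n dvd j"
    using primitive_root_of_unity_exists by metis
  have w12: "(w ^ j) ^ 12 = 1" for j
    using n(1) w(2)[of "j * 12"] by (simp flip: power_mult)
  have wi: "algebraic_int w"
    using w(1) \<open>n > 0\<close> by (intro algebraic_int_power_imp[of w n]) simp_all
  have geo: "(\<Sum>j<n. (w ^ e) ^ j) = (if n dvd e then of_nat n else 0)" for e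
  proof (cases "n dvd e")
    case True
    then show ?thesis using w(2)[of e] by simp
  next
    case False
    then have "w ^ e \<noteq> 1" using w(2) by simp
    moreover have "(w ^ e) ^ n = 1" using w(1) by (metis mult.commute power_mult power_one)
    ultimately show ?thesis using False by (simp add: geometric_sum)
  qed
  \<comment> \<open>The Fourier weight has exponent \<open>-i\<close>; using \<open>n - i\<close>
    instead keeps exponents natural.\<close>
  have dvd_iff: "n dvd k + (n - i) \<longleftrightarrow> k mod n = i" for k
  proof -
    have "n dvd k + (n - i) \<longleftrightarrow> n dvd (k + n) - i" using n by simp
    also have "\<dots> \<longleftrightarrow> (k + n) mod n = i mod n" using n by (intro mod_eq_dvd_iff_nat[symmetric]) simp
    finally show ?thesis using n by simp
  qed
  have "(\<Sum>j<n. w ^ ((n - i) * j) * poly (map_poly of_rat g) (\<alpha> * w ^ j))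
      = (\<Sum>j<n. \<Sum>k<12. of_rat (coeff g k) * \<alpha> ^ k * (w ^ (k + (n - i))) ^ j)"
  proof (rule sum.cong[OF refl])
    fix j
    have "poly (map_poly of_rat g) (\<alpha> * w ^ j) = (\<Sum>k<12. of_rat (coeff g k) * (\<alpha> * w ^ j) ^ k)"
      using g unfolding poly_altdef by (intro sum.mono_neutral_cong_left) (auto simp: coeff_eq_0)
    then show "w ^ ((n - i) * j) * poly (map_poly of_rat g) (\<alpha> * w ^ j) =
      (\<Sum>k<12. of_rat (coeff g k) * \<alpha> ^ k * (w ^ (k + (n - i))) ^ j)"
      by (simp add: sum_distrib_left power_mult_distrib mult_ac ring_distribs power_add flip: power_mult)
  qed
  also have "\<dots> = (\<Sum>k<12. of_rat (coeff g k) * \<alpha> ^ k * (\<Sum>j<n. (w ^ (k + (n - i))) ^ j))"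
    by (subst sum.swap) (simp add: sum_distrib_left)
  also have "\<dots> = (\<Sum>k<12. if k mod n = i then of_nat n * (of_rat (coeff g k) * \<alpha> ^ k) else 0)"
    unfolding geo dvd_iff by (intro sum.cong) auto
  also have "\<dots> = of_nat n * (\<Sum>k | k < 12 \<and> k mod n = i. of_rat (coeff g k) * \<alpha> ^ k)"
    by (simp add: sum_distrib_left sum.If_cases lessThan_def Collect_conj_eq Int_commute)
  finally have "of_nat n * (\<Sum>k | k < 12 \<and> k mod n = i. of_rat (coeff g k) * \<alpha> ^ k)
    = (\<Sum>j<n. w ^ ((n - i) * j) * poly (map_poly of_rat g) (\<alpha> * w ^ j))" ..
  also have "algebraic_int \<dots>"
    by (intro algebraic_int_sum algebraic_int_mult algebraic_int_power wi algebraic_int_conjugate int w12)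
  finally show ?thesis .
qed

text \<open>For \<open>n = 12\<close> the trace isolates one term, and its 12th power is rational
  because it turns \<open>\<alpha> ^ k\<close> into \<open>m ^ k\<close>.\<close>

lemma twelve_coeff_Ints:
  assumes "algebraic_int (eval g)" "degree g < 12" "k < 12"
  shows "12 * coeff g k \<in> \<int>"
proof -
  have "{l. l < 12 \<and> l mod 12 = k} = {k}" using assms(3) by auto
  then have "algebraic_int (12 * (of_rat (coeff g k) * \<alpha> ^ k))"
    using algebraic_int_trace[OF assms(1,2), of 12 k] assms(3) by simp
  then have "algebraic_int ((12 * (of_rat (coeff g k) * \<alpha> ^ k)) ^ 12)"
    by (rule algebraic_int_power)
  also have "(12 * (of_rat (coeff g k) * \<alpha> ^ k)) ^ 12 = 12 ^ 12 * of_rat (coeff g k) ^ 12 * (\<alpha> ^ 12) ^ k"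
    by (simp only: power_mult_distrib mult.assoc mult.commute[of k] flip: power_mult)
  also have "\<dots> = of_rat ((12 * coeff g k) ^ 12 * of_int m ^ k)"
    by (simp add: root of_rat_mult of_rat_power power_mult_distrib)
  finally have "of_rat ((12 * coeff g k) ^ 12 * of_int m ^ k) \<in> (\<int> :: complex set)"
    by (rule rational_algebraic_int_is_int) auto
  then obtain N where "of_rat ((12 * coeff g k) ^ 12 * of_int m ^ k) = (of_rat (of_int N) :: complex)"
    by (auto elim: Ints_cases)
  then have "(12 * coeff g k) ^ 12 * of_int m ^ k = of_int N"
    by (simp only: of_rat_eq_iff)
  then show ?thesis
    using rational_Ints_if_power_mult_Ints[OF squarefree assms(3)] by simp
qed

section \<open>Removing 2 and 3 from the denominators\<close>

text \<open>The trace over the \<open>n\<close>-th roots of unity extracts the exponents congruent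
  to \<open>i\<close>. Their common factor \<open>\<alpha> ^ i\<close> and the factor
  \<open>n\<close> can be removed because \<open>p\<close> divides neither \<open>m\<close> nor
  \<open>n\<close>.\<close>

lemma algebraic_int_residue_class_part:
  fixes b :: "nat \<Rightarrow> int"
  assumes int: "algebraic_int ((\<Sum>k<12. of_int (b k) * \<alpha> ^ k) / of_int p)"
    and p: "prime p" "\<not> p dvd m" "\<not> p dvd int n"
    and n: "n * l = 12" "i < n"
  shows "algebraic_int ((\<Sum>j<l. of_int (b (i + n * j)) * (\<alpha> ^ n) ^ j) / of_int p)"
proof -
  define g where "g = (\<Sum>k<12. monom (of_int (b k) / of_int p :: rat) k)"
  define S where "S = (\<Sum>j<l. of_int (b (i + n * j)) * (\<alpha> ^ n) ^ j)"
  have coeff: "coeff g k = (if k < 12 then of_int (b k) / of_int p else 0)" for k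
    by (simp add: g_def coeff_sum)
  have deg: "degree g < 12"
    using coeff by (intro degree_lessI) auto
  have "eval g = (\<Sum>k<12. of_int (b k) * \<alpha> ^ k) / of_int p"
    by (simp add: eval_eq_sum[OF deg] coeff of_rat_divide sum_divide_distrib)
  then have "algebraic_int (eval g)" using int by simp
  have range: "i + n * j < 12" if "j < l" for j
  proof -
    have "i + n * j < n * Suc j" using n(2) by simp
    also have "\<dots> \<le> n * l" using that by (intro mult_le_mono2) auto
    finally show ?thesis unfolding n(1) .
  qed
  from algebraic_int_trace[OF \<open>algebraic_int (eval g)\<close> deg _ n(2)] n(1)
  have "algebraic_int (of_nat n * (\<Sum>k | k < 12 \<and> k mod n = i. of_rat (coeff g k) * \<alpha> ^ k))"
    by (metis dvd_triv_left)
  also have "(\<Sum>k | k < 12 \<and> k mod n = i. of_rat (coeff g k) * \<alpha> ^ k) =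
    (\<Sum>j<l. of_rat (coeff g (i + n * j)) * \<alpha> ^ (i + n * j))"
  proof (rule sum.reindex_bij_witness[of _ "\<lambda>j. i + n * j" "\<lambda>k. k div n"])
    fix k assume k: "k \<in> {k. k < 12 \<and> k mod n = i}"
    then have "k mod n = i" "k < l * n" using n(1) by (simp_all add: mult.commute[of l])
    show "i + n * (k div n) = k"
      using mod_mult_div_eq[of k n] unfolding \<open>k mod n = i\<close> .
    show "k div n \<in> {..<l}" using \<open>k < l * n\<close> by (simp add: less_mult_imp_div_less)
  next
    fix j assume j: "j \<in> {..<l}"
    show "(i + n * j) div n = j" using n(2) by simp
    show "i + n * j \<in> {k. k < 12 \<and> k mod n = i}" using range[of j] j n(2) by simp
  qed auto
  also have "(\<Sum>j<l. of_rat (coeff g (i + n * j)) * \<alpha> ^ (i + n * j)) = \<alpha> ^ i * S / of_int p"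
    unfolding S_def sum_distrib_left sum_divide_distrib
  proof (rule sum.cong[OF refl])
    fix j assume "j \<in> {..<l}"
    then have "i + n * j < 12" by (intro range) simp
    then show "of_rat (coeff g (i + n * j)) * \<alpha> ^ (i + n * j) =
        \<alpha> ^ i * (of_int (b (i + n * j)) * (\<alpha> ^ n) ^ j) / of_int p"
      by (simp add: coeff of_rat_divide power_add power_mult)
  qed
  \<comment> \<open>Multiplying by \<open>\<alpha> ^ (12 - i)\<close> completes
    \<open>\<alpha> ^ i\<close> to \<open>m\<close>, an integer prime to \<open>p\<close>.\<close>
  finally have "algebraic_int (\<alpha> ^ (12 - i) * (of_nat n * (\<alpha> ^ i * S / of_int p)))"
    by (rule algebraic_int_mult[OF algebraic_int_power[OF algebraic_int_\<alpha>]])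
  also have "\<alpha> ^ (12 - i) * (of_nat n * (\<alpha> ^ i * S / of_int p)) = \<alpha> ^ (12 - i + i) * of_nat n * S / of_int p"
    by (simp add: power_add)
  also have "12 - i + i = 12"
  proof -
    have "n \<le> 12" by (rule dvd_imp_le[OF dvdI[OF n(1)[symmetric]]]) simp
    then show ?thesis using n(2) by simp
  qed
  also have "\<alpha> ^ 12 * of_nat n * S = of_int (m * int n) * S" by (simp add: root)
  finally have mS: "algebraic_int (of_int (m * int n) * S / of_int p)" .
  have S: "algebraic_int S"
    unfolding S_def by (intro algebraic_int_sum algebraic_int_mult algebraic_int_power
        algebraic_int_\<alpha> algebraic_int_of_int)
  have "\<not> p dvd m * int n"
    using p by (simp add: prime_dvd_mult_iff)
  with p(1) have "coprime p (m * int n)" by (rule prime_imp_coprime)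
  then have "coprime (m * int n) p" by (subst coprime_commute)
  moreover have "p \<noteq> 0" using p(1) by auto
  ultimately have "algebraic_int (S / of_int p)"
    by (rule algebraic_int_divide_coprime[OF S mS])
  then show ?thesis unfolding S_def .
qed

text \<open>For odd \<open>m\<close>, the class of \<open>k\<close> modulo 3 gives a quartic problem
  for \<open>\<alpha> ^ 3\<close>, whose fourth power is \<open>m\<close>; the extra factor 3 is
  prime to 2.\<close>

lemma coeffs_even:
  fixes b :: "nat \<Rightarrow> int"
  assumes m: "[m = 2] (mod 4) \<or> [m = 3] (mod 4)"
    and int: "algebraic_int ((\<Sum>k<12. of_int (b k) * \<alpha> ^ k) / of_int 2)" and "k < 12"
  shows "2 dvd b k"
proof (cases "even m")
  case True
  then show ?thesis by (intro coeffs_dvd_if_prime_dvd[OF _ _ int]) (use \<open>k < 12\<close> in auto)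
next
  case False
  have "\<not> [m = 2] (mod 4)" using False by (auto simp: cong_def) presburger
  with m have "[m = 3] (mod 4)" by simp
  moreover have "algebraic_int ((\<Sum>j<4. of_int (b (k mod 3 + 3 * j)) * (\<alpha> ^ 3) ^ j) / of_int 2)"
    by (intro algebraic_int_residue_class_part[OF int]) (use False in auto)
  ultimately have "even (b (k mod 3 + 3 * (k div 3)))"
    using \<open>k < 12\<close> by (intro quartic_coeffs_even[of "\<alpha> ^ 3" m "\<lambda>j. b (k mod 3 + 3 * j)"])
      (auto simp: root simp flip: power_mult)
  then show ?thesis by (simp add: add.commute)
qed

text \<open>For \<open>m\<close> prime to 3, classes modulo 4 give a cubic problem for
  \<open>\<alpha> ^ 4\<close>; the extra factor 4 is prime to 3.\<close>

lemma coeffs_dvd_3: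
  fixes b :: "nat \<Rightarrow> int"
  assumes m: "\<not> [m = 1] (mod 9)" "\<not> [m = -1] (mod 9)"
    and int: "algebraic_int ((\<Sum>k<12. of_int (b k) * \<alpha> ^ k) / of_int 3)" and "k < 12"
  shows "3 dvd b k"
proof (cases "3 dvd m")
  case True
  then show ?thesis by (intro coeffs_dvd_if_prime_dvd[OF _ _ int]) (use \<open>k < 12\<close> in auto)
next
  case False
  have "algebraic_int ((\<Sum>j<3. of_int (b (k mod 4 + 4 * j)) * (\<alpha> ^ 4) ^ j) / of_int 3)"
    by (intro algebraic_int_residue_class_part[OF int]) (use False in auto)
  then have "3 dvd b (k mod 4 + 4 * (k div 4))"
    using \<open>k < 12\<close> False m by (intro cubic_coeffs_dvd_3[of "\<alpha> ^ 4" m "\<lambda>j. b (k mod 4 + 4 * j)"])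
      (auto simp: root simp flip: power_mult)
  then show ?thesis by (simp add: add.commute)
qed

text \<open>Strips one factor \<open>p\<close> from a common denominator \<open>d * p\<close> of the
  coefficients: \<open>d * x\<close> is integral, so \<open>dvd\<close> applies to \<open>a\<close>
  and the integer divisions are exact.\<close>

lemma algebraic_int_divide_step:
  fixes a :: "nat \<Rightarrow> int"
  assumes x: "algebraic_int x" "of_int (d * p) * x = (\<Sum>k<12. of_int (a k) * \<alpha> ^ k)" and p: "p \<noteq> 0"
    and dvd: "\<And>b k. algebraic_int ((\<Sum>k<12. of_int (b k) * \<alpha> ^ k) / of_int p) \<Longrightarrow> k < 12 \<Longrightarrow> p dvd b k"
  shows "of_int d * x = (\<Sum>k<12. of_int (a k div p) * \<alpha> ^ k)"
proof -
  have dx: "of_int d * x = (\<Sum>k<12. of_int (a k) * \<alpha> ^ k) / of_int p"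
    using p by (simp flip: x(2))
  then have "p dvd a k" if "k < 12" for k
    using x(1) that by (metis dvd algebraic_int_mult algebraic_int_of_int)
  then show ?thesis
    using p by (auto simp: dx sum_divide_distrib of_int_div intro!: sum.cong)
qed

section \<open>The ring of integers is \<int>[\<alpha>]\<close>

lemma ring_of_integers_rat_adjoin:
  assumes m: "[m = 2] (mod 4) \<or> [m = 3] (mod 4)" "\<not> [m = 1] (mod 9)" "\<not> [m = -1] (mod 9)"
  shows "ring_of_integers (rat_adjoin \<alpha>) = int_adjoin \<alpha>"
proof (intro equalityI subsetI)
  fix x assume "x \<in> ring_of_integers (rat_adjoin \<alpha>)"
  then have x: "algebraic_int x" "x \<in> rat_adjoin \<alpha>" by (auto simp: ring_of_integers_def)
  from x(2) rat_adjoin_subset obtain h where "x = eval h" by auto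
  define g where "g = h mod F"
  have g: "x = eval g" "degree g < 12"
    by (simp_all add: g_def eval_mod_F degree_mod_F \<open>x = eval h\<close>)
  have "\<exists>a. 12 * coeff g k = of_int a" if "k < 12" for k
    using twelve_coeff_Ints[of g k] g x(1) that by (auto elim!: Ints_cases)
  then obtain a where a: "\<And>k. k < 12 \<Longrightarrow> 12 * coeff g k = of_int (a k)" by metis
  \<comment> \<open>The denominator 12 is stripped in the order 2, 2, 3; the products
    \<open>6 * 2\<close>, \<open>3 * 2\<close> and \<open>1 * 3\<close> have the shape
    \<open>d * p\<close> of the division step.\<close>
  have "of_int (6 * 2) * x = (\<Sum>k<12. of_rat (12 * coeff g k) * \<alpha> ^ k)"
    unfolding g(1) eval_eq_sum[OF g(2)] by (simp add: sum_distrib_left of_rat_mult mult.assoc)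
  also have "\<dots> = (\<Sum>k<12. of_int (a k) * \<alpha> ^ k)" by (intro sum.cong) (simp_all add: a)
  finally have 12: "of_int (6 * 2) * x = (\<Sum>k<12. of_int (a k) * \<alpha> ^ k)" .
  have "of_int 6 * x = (\<Sum>k<12. of_int (a k div 2) * \<alpha> ^ k)"
    by (rule algebraic_int_divide_step[OF x(1) 12]) (simp, erule coeffs_even[OF m(1)])
  then have 6: "of_int (3 * 2) * x = (\<Sum>k<12. of_int (a k div 2) * \<alpha> ^ k)" by simp
  have "of_int 3 * x = (\<Sum>k<12. of_int (a k div 2 div 2) * \<alpha> ^ k)"
    by (rule algebraic_int_divide_step[OF x(1) 6]) (simp, erule coeffs_even[OF m(1)])
  then have 3: "of_int (1 * 3) * x = (\<Sum>k<12. of_int (a k div 2 div 2) * \<alpha> ^ k)" by simp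
  have "of_int 1 * x = (\<Sum>k<12. of_int (a k div 2 div 2 div 3) * \<alpha> ^ k)"
    by (rule algebraic_int_divide_step[OF x(1) 3]) (simp, erule coeffs_dvd_3[OF m(2,3)])
  also have "\<dots> = poly (of_int_poly (\<Sum>k<12. monom (a k div 2 div 2 div 3) k)) \<alpha>"
    by (simp add: of_int_poly_hom.hom_sum poly_sum poly_monom)
  finally show "x \<in> int_adjoin \<alpha>" unfolding int_adjoin_altdef by simp
next
  fix x assume x: "x \<in> int_adjoin \<alpha>"
  then have "x \<in> rat_adjoin \<alpha>"
    unfolding int_adjoin_def rat_adjoin_def
    by (induction rule: generate_ring.induct) (blast intro: generate_field.intros)+
  moreover obtain p :: "int poly" where "x = poly (of_int_poly p) \<alpha>"
    using x unfolding int_adjoin_altdef by auto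
  then have "algebraic_int x"
    by (auto simp: poly_altdef intro!: algebraic_int_sum algebraic_int_mult algebraic_int_power algebraic_int_\<alpha>)
  ultimately show "x \<in> ring_of_integers (rat_adjoin \<alpha>)" by (simp add: ring_of_integers_def)
qed

end

theorem theorem2p1:
  fixes m :: int and f :: "int poly" and \<alpha> :: complex and K :: "complex set"
  assumes "m \<noteq> 1" and "m \<noteq> -1" and "squarefree m"
    and "f = monom 1 12 - [:m:]"
    and "poly (map_poly of_int f) \<alpha> = 0"
    and "K = rat_adjoin \<alpha>"
    and "[m = 2] (mod 4) \<or> [m = 3] (mod 4)"
    and "\<not> [m = 1] (mod 9)" and "\<not> [m = -1] (mod 9)"
  shows "ring_of_integers K = int_adjoin \<alpha>"
proof -
  have "\<alpha> ^ 12 = of_int m"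
    using assms(5) unfolding assms(4)
    by (simp add: of_int_poly_hom.hom_minus poly_monom of_int_hom.map_poly_pCons_hom)
  with assms interpret pure_degree_12 m \<alpha>
    by unfold_locales
  show ?thesis
    unfolding \<open>K = rat_adjoin \<alpha>\<close> by (rule ring_of_integers_rat_adjoin) fact+
qed

end
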